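(* Every $k$-tunnel gadget that is reversible, deterministic, and has interacting tunnels simulates a locking 2-toggle.
   Context: A gadget consists of finitely many locations and finitely many states; each state $s$ has a set of transitions $(a,b,s')$ meaning a robot may enter at location $a$, exit at location $b$, and the gadget's state becomes $s'$. The transition graph is the directed graph on state/location pairs with an edge $(s,a)\to(s',b)$ for each transition. A $k$-tunnel gadget has $2k$ locations partitioned into $k$ pairs called tunnels, and every transition goes between the two locations of one tunnel. It has interacting tunnels if some transition across a tunnel from a state $s$ to a state $s'$ changes the set of allowed traversal directions of some other tunnel. It is deterministic if the transition graph has out-degree at most 1, and reversible if the reverse of every transition-graph edge is also an edge. The locking 2-toggle is the 2-tunnel gadget with tunnels $\{a_1,b_1\}$ and $\{a_2,b_2\}$ and three states $M,S_1,S_2$: in $M$ the only transitions are $a_1\to b_1$ (to $S_1$) and $a_2\to b_2$ (to $S_2$); in $S_i$ the only transition is $b_i\to a_i$ (back to $M$). A system of gadgets consists of copies of gadgets, initial states, and a connection graph on locations; a robot moves freely along connection-graph paths and traverses gadgets according to their states. A gadget $G$ simulates a gadget $H$ if there is a system of copies of $G$ with some of its locations designated as the locations of $H$ and with each state of $H$ corresponding to a configuration of the system, such that, from the configuration corresponding to any state $q$ of $H$, a robot entering the system at a designated location $a$ can exit at a designated location $b$ leaving the system in the configuration corresponding to state $q'$ exactly when $H$ has a transition $(a,b,q')$ in state $q$, and no other behavior is possible; consequently copies of $H$ in any system may be replaced by this construction. *)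

theory Defs
  imports Main "HOL-Library.Disjoint_Sets"
begin

text \<open>
  A transition \<open>(s, a, b, s')\<close> says that, in state \<open>s\<close>, a robot may enter at \<open>a\<close>, exit at \<open>b\<close>,
  and thereby change the state to \<open>s'\<close>.
\<close>

record ('q, 'l) gadget =
  states :: "'q set"
  locs :: "'l set"
  trans :: "('q \<times> 'l \<times> 'l \<times> 'q) set"

definition is_gadget :: "('q, 'l) gadget \<Rightarrow> bool" where
  "is_gadget G \<longleftrightarrow> finite (states G) \<and> finite (locs G) \<and>
     trans G \<subseteq> states G \<times> locs G \<times> locs G \<times> states G"

definition transition_graph :: "('q, 'l) gadget \<Rightarrow> (('q \<times> 'l) \<times> ('q \<times> 'l)) set" where
  "transition_graph G = {((s, a), (s', b)) | s a b s'. (s, a, b, s') \<in> trans G}"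

definition deterministic :: "('q, 'l) gadget \<Rightarrow> bool" where
  "deterministic G \<longleftrightarrow> single_valued (transition_graph G)"

definition reversible :: "('q, 'l) gadget \<Rightarrow> bool" where
  "reversible G \<longleftrightarrow> sym (transition_graph G)"

text \<open>
  The tunnels \<open>T\<close> are two-element sets of locations, so the last conjunct also excludes
  transitions that exit where they entered.
\<close>

definition tunnel_gadget :: "nat \<Rightarrow> 'l set set \<Rightarrow> ('q, 'l) gadget \<Rightarrow> bool" where
  "tunnel_gadget k T G \<longleftrightarrow> is_gadget G \<and>
     card (locs G) = 2 * k \<and> partition_on (locs G) T \<and> card T = k \<and> (\<forall>t\<in>T. card t = 2) \<and>
     (\<forall>(s, a, b, s') \<in> trans G. {a, b} \<in> T)"

definition directions :: "('q, 'l) gadget \<Rightarrow> 'l set \<Rightarrow> 'q \<Rightarrow> ('l \<times> 'l) set" where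
  "directions G t s = {(a, b). {a, b} = t \<and> (\<exists>s'. (s, a, b, s') \<in> trans G)}"

definition interacting_tunnels :: "'l set set \<Rightarrow> ('q, 'l) gadget \<Rightarrow> bool" where
  "interacting_tunnels T G \<longleftrightarrow>
     (\<exists>(s, a, b, s') \<in> trans G. \<exists>t\<in>T. t \<noteq> {a, b} \<and> directions G t s \<noteq> directions G t s')"

datatype l2t_state = L2T_M | L2T_S1 | L2T_S2
datatype l2t_loc = L2T_a1 | L2T_b1 | L2T_a2 | L2T_b2

definition locking_2_toggle :: "(l2t_state, l2t_loc) gadget" where
  "locking_2_toggle =
     \<lparr> states = {L2T_M, L2T_S1, L2T_S2},
       locs = {L2T_a1, L2T_b1, L2T_a2, L2T_b2},
       trans = {(L2T_M, L2T_a1, L2T_b1, L2T_S1), (L2T_M, L2T_a2, L2T_b2, L2T_S2),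
                (L2T_S1, L2T_b1, L2T_a1, L2T_M), (L2T_S2, L2T_b2, L2T_a2, L2T_M)} \<rparr>"

text \<open>
  A system of \<open>n\<close> copies of \<open>G\<close>: location \<open>a\<close> of copy \<open>i\<close> is the pair \<open>(i, a)\<close>, and a configuration
  lists the current states of the copies. The initial states of a system are a configuration;
  in a simulation they are chosen as the configuration of the desired state of the simulated gadget.
\<close>

definition system_locs :: "('q, 'l) gadget \<Rightarrow> nat \<Rightarrow> (nat \<times> 'l) set" where
  "system_locs G n = {..<n} \<times> locs G"

definition configurations :: "('q, 'l) gadget \<Rightarrow> nat \<Rightarrow> 'q list set" where
  "configurations G n = {c. length c = n \<and> set c \<subseteq> states G}"

definition connection_graph ::
  "('q, 'l) gadget \<Rightarrow> nat \<Rightarrow> ((nat \<times> 'l) \<times> (nat \<times> 'l)) set \<Rightarrow> bool" where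
  "connection_graph G n E \<longleftrightarrow> E \<subseteq> system_locs G n \<times> system_locs G n \<and> sym E"

inductive_set robot_moves ::
  "('q, 'l) gadget \<Rightarrow> ((nat \<times> 'l) \<times> (nat \<times> 'l)) set \<Rightarrow>
     (('q list \<times> (nat \<times> 'l)) \<times> ('q list \<times> (nat \<times> 'l))) set"
  for G :: "('q, 'l) gadget" and E :: "((nat \<times> 'l) \<times> (nat \<times> 'l)) set" where
  walk: "(p, p') \<in> E \<Longrightarrow> ((c, p), (c, p')) \<in> robot_moves G E"
| traverse: "i < length c \<Longrightarrow> (c ! i, a, b, s') \<in> trans G \<Longrightarrow>
    ((c, (i, a)), (c[i := s'], (i, b))) \<in> robot_moves G E"

text \<open>
  \<open>port\<close> designates locations of the system as the locations of \<open>H\<close>, and \<open>conf\<close> gives the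
  configuration of each state of \<open>H\<close>. On the side of \<open>H\<close> the reflexive transitive closure is needed
  because a robot can always leave where it entered without having done anything, and because a
  robot that has reached a designated location may re-enter there instead of leaving, which amounts
  to several successive traversals of \<open>H\<close>. For the locking 2-toggle only the former adds anything
  to the single transitions, see \<open>locking_2_toggle_rtrancl\<close> below.
\<close>

definition simulates :: "('q, 'l) gadget \<Rightarrow> ('r, 'm) gadget \<Rightarrow> bool" where
  "simulates G H \<longleftrightarrow>
     (\<exists>n E port conf.
        connection_graph G n E \<and>
        inj_on port (locs H) \<and> port ` locs H \<subseteq> system_locs G n \<and>
        conf ` states H \<subseteq> configurations G n \<and>
        (\<forall>q \<in> states H. \<forall>a \<in> locs H. \<forall>b \<in> locs H.
           (\<forall>q' \<in> states H.
              ((conf q, port a), (conf q', port b)) \<in> (robot_moves G E)\<^sup>* \<longleftrightarrow>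
              ((q, a), (q', b)) \<in> (transition_graph H)\<^sup>*) \<and>
           (\<forall>c. ((conf q, port a), (c, port b)) \<in> (robot_moves G E)\<^sup>* \<longrightarrow>
              c \<in> conf ` states H)))"

lemma locking_2_toggle_tunnels:
  "tunnel_gadget 2 {{L2T_a1, L2T_b1}, {L2T_a2, L2T_b2}} locking_2_toggle"
  by (auto simp: tunnel_gadget_def is_gadget_def locking_2_toggle_def partition_on_def
      disjoint_def doubleton_eq_iff)

lemma locking_2_toggle_rtrancl:
  "((q, a), (q', b)) \<in> (transition_graph locking_2_toggle)\<^sup>* \<longleftrightarrow>
     (q, a) = (q', b) \<or> (q, a, b, q') \<in> trans locking_2_toggle"
proof
  assume "((q, a), (q', b)) \<in> (transition_graph locking_2_toggle)\<^sup>*"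
  then show "(q, a) = (q', b) \<or> (q, a, b, q') \<in> trans locking_2_toggle"
    by (induction rule: rtrancl_induct2)
      (auto simp: transition_graph_def locking_2_toggle_def)
next
  assume "(q, a) = (q', b) \<or> (q, a, b, q') \<in> trans locking_2_toggle"
  then show "((q, a), (q', b)) \<in> (transition_graph locking_2_toggle)\<^sup>*"
    by (auto simp: transition_graph_def)
qed

end

theory Submission
  imports Defs
begin

text \<open>
  In a reversible deterministic tunnel gadget, every directed tunnel acts on the states as a partial
  injection. By interaction there are two tunnels with partial injections \<open>f\<close>, \<open>h\<close> and a state \<open>s\<close>
  such that \<open>f s\<close> and \<open>h s\<close> are defined, but \<open>h (f s)\<close> is not. Take two copies of the gadget in
  state \<open>s\<close>; put \<open>f\<close> of the first copy in series with \<open>h\<close> of the second one, and \<open>f\<close> of the second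
  copy in series with \<open>h\<close> of the first one. Traversing either of these two lines blocks the other.

  It remains to ensure that each line can only be traversed back and forth. One of \<open>f\<close>, \<open>h\<close> and
  \<open>h \<circ> f\<close> is a partial injection \<open>w\<close> whose domain differs from its range: otherwise, for
  \<open>D = dom f \<inter> dom h\<close>, the domain \<open>f\<inverse>(D)\<close> of \<open>h \<circ> f\<close> would be contained in \<open>D\<close>, hence equal to
  \<open>D\<close> by cardinality, but \<open>s \<in> D\<close> and \<open>f s \<notin> D\<close>. Choose \<open>x\<close> in the domain of \<open>w\<close>
  but not in the range, and \<open>w y\<close> in the range but not in the domain. Two copies
  of \<open>w\<close> in series, in states \<open>x\<close> and \<open>y\<close>, can be traversed forwards once and then only backwards,
  so appending them to each of the lines yields a locking 2-toggle.
\<close>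

section \<open>Partial injections\<close>

text \<open>Both projections are injective on \<open>R\<close>, so domain and range are each in
  bijection with \<open>R\<close>.\<close>

lemma card_Domain_eq_card_Range:
  assumes "single_valued R" "single_valued (R\<inverse>)"
  shows "card (Domain R) = card (Range R)"
proof -
  have "inj_on fst R" "inj_on snd R"
    using assms by (auto simp: inj_on_def single_valued_def)
  then show ?thesis
    by (simp add: Domain_fst Range_snd card_image)
qed

text \<open>Domain and range have the same finite cardinality, so if they differ, neither contains
  the other.\<close>

lemma Domain_neq_Range_obtains:
  assumes "finite R" "single_valued R" "single_valued (R\<inverse>)" "Domain R \<noteq> Range R"
  obtains x x' y y' where "(x, x') \<in> R" "x \<notin> Range R" "(y, y') \<in> R" "y' \<notin> Domain R"
proof -
  have fin: "finite (Domain R)" "finite (Range R)"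
    using assms(1) by (auto intro: finite_Domain finite_Range)
  have "card (Domain R) = card (Range R)"
    using card_Domain_eq_card_Range assms(2,3) .
  then have "\<not> Domain R \<subseteq> Range R" "\<not> Range R \<subseteq> Domain R"
    using card_subset_eq[OF fin(2)] card_subset_eq[OF fin(1)] assms(4) by metis+
  then show thesis
    using that by blast
qed

lemma Domain_neq_Range_relcomp:
  assumes "finite f" "single_valued f" "single_valued (f\<inverse>)"
    and "Domain f = Range f" "Domain h = Range h"
    and "(s, s') \<in> f" "s \<in> Domain h" "s' \<notin> Domain h"
  shows "Domain (f O h) \<noteq> Range (f O h)"
proof
  assume eq: "Domain (f O h) = Range (f O h)"
  let ?D = "Domain f \<inter> Domain h"
  \<comment> \<open>The part of \<open>f\<close> that lands in \<open>?D\<close>: its domain is that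
    of \<open>f O h\<close>, and its range is all of \<open>?D\<close> because \<open>?D\<close>
    lies in \<open>Range f\<close>.\<close>
  let ?f = "f \<inter> UNIV \<times> ?D"
  have dom: "Domain ?f = Domain (f O h)"
    using assms(4) by auto
  have "card (Domain ?f) = card (Range ?f)"
    by (rule card_Domain_eq_card_Range) (use assms(2,3) in \<open>auto simp: single_valued_def\<close>)
  also have "Range ?f = ?D"
    using assms(4) by auto
  finally have "card (Domain (f O h)) = card ?D"
    unfolding dom .
  moreover have "Domain (f O h) \<subseteq> ?D"
    using eq assms(5) by blast
  moreover have "finite ?D"
    using assms(1) by (simp add: finite_Domain)
  ultimately have "Domain (f O h) = ?D"
    by (simp add: card_subset_eq)
  then obtain u v where "(s, u) \<in> f" "(u, v) \<in> h"
    using assms(6,7) by blast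
  then show False
    using single_valuedD[OF assms(2,6)] assms(8) by blast
qed

section \<open>Lines of tunnels\<close>

text \<open>A triple \<open>(i, a, b)\<close> stands for the passage of copy \<open>i\<close> from location \<open>a\<close> to location \<open>b\<close>.\<close>

fun entry :: "nat \<times> 'l \<times> 'l \<Rightarrow> nat \<times> 'l" where
  "entry (i, a, b) = (i, a)"

fun exit :: "nat \<times> 'l \<times> 'l \<Rightarrow> nat \<times> 'l" where
  "exit (i, a, b) = (i, b)"

fun flip :: "nat \<times> 'l \<times> 'l \<Rightarrow> nat \<times> 'l \<times> 'l" where
  "flip (i, a, b) = (i, b, a)"

lemma entry_flip [simp]: "entry (flip x) = exit x"
  and exit_flip [simp]: "exit (flip x) = entry x"
  by (cases x; simp)+

fun pass :: "('q, 'l) gadget \<Rightarrow> nat \<times> 'l \<times> 'l \<Rightarrow> 'q list rel" where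
  "pass G (i, a, b) =
     {(c, c'). i < length c \<and> (\<exists>s'. (c ! i, a, b, s') \<in> trans G \<and> c' = c[i := s'])}"

primrec line :: "('q, 'l) gadget \<Rightarrow> (nat \<times> 'l \<times> 'l) list \<Rightarrow> 'q list rel" where
  "line G [] = Id"
| "line G (x # L) = pass G x O line G L"

lemma line_append: "line G (L @ L') = line G L O line G L'"
  by (induction L) (auto simp: O_assoc)

text \<open>The counterpart of \<open>line\<close> for a single copy, acting on its state instead of
  a configuration.\<close>

primrec path :: "('q, 'l) gadget \<Rightarrow> ('l \<times> 'l) list \<Rightarrow> 'q rel" where
  "path G [] = Id"
| "path G (x # w) = {(s, s'). (s, fst x, snd x, s') \<in> trans G} O path G w"

lemma line_map_Pair:
  "(c ! i, s) \<in> path G w \<Longrightarrow> i < length c \<Longrightarrow> (c, c[i := s]) \<in> line G (map (Pair i) w)"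
proof (induction w arbitrary: c)
  case Nil
  then show ?case
    by auto
next
  case (Cons x w)
  then obtain s' where "(c ! i, fst x, snd x, s') \<in> trans G" "(s', s) \<in> path G w"
    by auto
  then have "(c, c[i := s']) \<in> pass G (i, x)" "(c[i := s'], c[i := s', i := s]) \<in> line G (map (Pair i) w)"
    using Cons.IH[of "c[i := s']"] Cons.prems(2) by (cases x; auto)+
  then show ?case
    by auto
qed

lemma line_length: "(c, c') \<in> line G L \<Longrightarrow> length c' = length c"
  by (induction L arbitrary: c) force+

text \<open>Passages of other copies leave \<open>c ! i\<close> alone. As other copies may block the
  line, this is only a necessary condition; it serves to refute traversals.\<close>

lemma line_nth:
  "(c, c') \<in> line G L \<Longrightarrow> i < length c \<Longrightarrow>
     (c ! i, c' ! i) \<in> path G (map snd (filter (\<lambda>x. fst x = i) L))"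
proof (induction L arbitrary: c)
  case (Cons x L)
  then show ?case
    by (cases x) (fastforce simp: nth_list_update)
qed simp

text \<open>The line \<open>L\<close> is connected in series by \<open>E\<close>, and \<open>E\<close> has no other edges at its locations.\<close>

definition laid_out :: "((nat \<times> 'l) \<times> (nat \<times> 'l)) set \<Rightarrow> (nat \<times> 'l \<times> 'l) list \<Rightarrow> bool" where
  "laid_out E L \<longleftrightarrow> L \<noteq> [] \<and> distinct (map entry L @ map exit L) \<and>
     (\<forall>k<length L. \<forall>p. (entry (L ! k), p) \<in> E \<longleftrightarrow> 0 < k \<and> p = exit (L ! (k - 1))) \<and>
     (\<forall>k<length L. \<forall>p. (exit (L ! k), p) \<in> E \<longleftrightarrow> Suc k < length L \<and> p = entry (L ! Suc k))"

lemma laid_outD: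
  assumes "laid_out E L"
  shows "L \<noteq> []" "distinct (map entry L @ map exit L)"
    and "k < length L \<Longrightarrow> (entry (L ! k), p) \<in> E \<longleftrightarrow> 0 < k \<and> p = exit (L ! (k - 1))"
    and "k < length L \<Longrightarrow> (exit (L ! k), p) \<in> E \<longleftrightarrow> Suc k < length L \<and> p = entry (L ! Suc k)"
  using assms unfolding laid_out_def by (simp_all del: split_paired_All)

text \<open>Turning a line around exchanges entries with exits and each index with its mirror image,
  which preserves the conditions on \<open>E\<close>. Results about robots at one end thus carry
  over to the other end.\<close>

lemma laid_out_rev:
  assumes "laid_out E L"
  shows "laid_out E (rev (map flip L))"
proof -
  let ?R = "rev (map flip L)"
  note E = laid_outD(3,4)[OF assms]
  have "map entry ?R = rev (map exit L)" "map exit ?R = rev (map entry L)"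
    by (simp_all add: rev_map comp_def)
  then have "distinct (map entry ?R @ map exit ?R)"
    using laid_outD(2)[OF assms] by (simp only: distinct_append distinct_rev set_rev Int_commute)
  moreover have ends: "entry (?R ! k) = exit (L ! (length L - Suc k))"
    "exit (?R ! k) = entry (L ! (length L - Suc k))" if "k < length L" for k
    using that by (simp_all add: rev_nth)
  have "(entry (?R ! k), p) \<in> E \<longleftrightarrow> 0 < k \<and> p = exit (?R ! (k - 1))" if "k < length L" for k p
    using that by (cases k) (auto simp: ends E Suc_diff_Suc)
  moreover have "(exit (?R ! k), p) \<in> E \<longleftrightarrow> Suc k < length L \<and> p = entry (?R ! Suc k)"
    if "k < length L" for k p
    using that by (auto simp: ends E)
  moreover have "L \<noteq> []"
    using laid_outD(1) assms .
  ultimately show ?thesis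
    unfolding laid_out_def by simp
qed

definition series :: "(nat \<times> 'l \<times> 'l) list \<Rightarrow> ((nat \<times> 'l) \<times> (nat \<times> 'l)) set" where
  "series L = {(exit (L ! k), entry (L ! Suc k)) | k. Suc k < length L}"

text \<open>The ends of all passages of both lines are distinct, so the edges of \<open>Y\<close>
  touch no end of \<open>X\<close>, even where both lines use the same copy.\<close>

lemma laid_out_series:
  assumes "X \<noteq> []" and dist: "distinct (map entry (X @ Y) @ map exit (X @ Y))"
    and E: "E = series X \<union> (series X)\<inverse> \<union> series Y \<union> (series Y)\<inverse>"
  shows "laid_out E X"
proof -
  have sets: "entry ` set (X @ Y) \<inter> exit ` set (X @ Y) = {}" "entry ` set X \<inter> entry ` set Y = {}"
    "exit ` set X \<inter> exit ` set Y = {}"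
    and maps: "distinct (map entry X)" "distinct (map exit X)"
    using dist by (simp_all only: distinct_append map_append set_map set_append image_Un)
  have inj: "entry (X ! i) = entry (X ! j) \<longleftrightarrow> i = j" "exit (X ! i) = exit (X ! j) \<longleftrightarrow> i = j"
    if "i < length X" "j < length X" for i j
    using nth_eq_iff_index_eq[OF maps(1), of i j] nth_eq_iff_index_eq[OF maps(2), of i j] that
    by simp_all
  have disj: "entry (X ! i) \<noteq> exit (X ! j)" "exit (X ! i) \<noteq> entry (X ! j)"
    if "i < length X" "j < length X" for i j
    using sets(1) nth_mem[OF that(1)] nth_mem[OF that(2)] unfolding set_append by blast+
  have disj': "entry (X ! i) \<noteq> entry (Y ! j)" "entry (X ! i) \<noteq> exit (Y ! j)"
    "exit (X ! i) \<noteq> entry (Y ! j)" "exit (X ! i) \<noteq> exit (Y ! j)"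
    if "i < length X" "j < length Y" for i j
    using sets nth_mem[OF that(1)] nth_mem[OF that(2)] unfolding set_append by blast+
  have "(entry (X ! k), p) \<in> E \<longleftrightarrow> 0 < k \<and> p = exit (X ! (k - 1))" if "k < length X" for k p
    using that by (cases k) (auto simp: E series_def inj disj disj')
  moreover have "(exit (X ! k), p) \<in> E \<longleftrightarrow> Suc k < length X \<and> p = entry (X ! Suc k)"
    if "k < length X" for k p
    using that by (auto simp: E series_def inj disj disj')
  ultimately show ?thesis
    using assms(1) dist unfolding laid_out_def by auto
qed

section \<open>Passages of a reversible deterministic tunnel gadget\<close>

locale reversible_tunnels =
  fixes G :: "('q, 'l) gadget" and T :: "'l set set" and k :: nat
  assumes tunnel_gadget: "tunnel_gadget k T G"
    and reversible: "reversible G"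
    and deterministic: "deterministic G"
begin

lemma trans_rev: "(s, a, b, s') \<in> trans G \<Longrightarrow> (s', b, a, s) \<in> trans G"
  using reversible by (auto simp: reversible_def transition_graph_def sym_def)

lemma trans_unique:
  "(s, a, b, s') \<in> trans G \<Longrightarrow> (s, a, b', s'') \<in> trans G \<Longrightarrow> b' = b \<and> s'' = s'"
  using deterministic by (auto simp: deterministic_def transition_graph_def single_valued_def)

lemma trans_tunnel: "(s, a, b, s') \<in> trans G \<Longrightarrow> {a, b} \<in> T"
  using tunnel_gadget by (auto simp: tunnel_gadget_def)

lemma trans_states: "(s, a, b, s') \<in> trans G \<Longrightarrow> s \<in> states G \<and> s' \<in> states G"
  using tunnel_gadget by (auto simp: tunnel_gadget_def is_gadget_def)

lemma tunnel_locs: "{a, b} \<in> T \<Longrightarrow> a \<in> locs G \<and> b \<in> locs G"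
  using tunnel_gadget by (auto simp: tunnel_gadget_def partition_on_def)

lemma tunnel_neq: "{a, b} \<in> T \<Longrightarrow> a \<noteq> b"
  using tunnel_gadget by (fastforce simp: tunnel_gadget_def)

lemma tunnels_disjoint: "t \<in> T \<Longrightarrow> u \<in> T \<Longrightarrow> t \<noteq> u \<Longrightarrow> t \<inter> u = {}"
  using tunnel_gadget by (auto simp: tunnel_gadget_def partition_on_def disjoint_def)

lemma tunnel_exit: "{a, b} \<in> T \<Longrightarrow> {a, b'} \<in> T \<Longrightarrow> b' = b"
  using tunnels_disjoint[of "{a, b}" "{a, b'}"] by (auto simp: doubleton_eq_iff)

text \<open>Reversibility gives one inclusion; since \<open>flip\<close> is an involution, the other
  one follows.\<close>

lemma pass_flip: "pass G (flip x) = (pass G x)\<inverse>"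
proof -
  have "(c', c) \<in> pass G (flip y)" if pass: "(c, c') \<in> pass G y" for c c' y
  proof -
    obtain i a b s' where "y = (i, a, b)" "i < length c" "(c ! i, a, b, s') \<in> trans G" "c' = c[i := s']"
      using pass by (cases y) auto
    then show ?thesis
      using trans_rev by (auto intro!: exI[of _ "c ! i"])
  qed
  moreover have "flip (flip x) = x"
    by (cases x) simp
  ultimately show ?thesis
    by (metis converse_iff subrelI subset_antisym)
qed

lemma single_valued_pass: "single_valued (pass G x)"
  by (cases x) (auto simp: single_valued_def dest: trans_unique)

lemma line_rev: "line G (rev (map flip L)) = (line G L)\<inverse>"
  by (induction L) (auto simp: line_append pass_flip converse_relcomp)

lemma single_valued_line: "single_valued (line G L)"
  by (induction L) (auto simp: single_valued_pass single_valued_relcomp)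

lemma line_unique: "(c, c') \<in> line G L \<Longrightarrow> (c, c'') \<in> line G L \<longleftrightarrow> c'' = c'"
  using single_valued_line[of L] by (auto simp: single_valued_def)

lemma line_unique_rev: "(c', c) \<in> line G L \<Longrightarrow> (c'', c) \<in> line G L \<longleftrightarrow> c'' = c'"
  using line_unique[of c c' "rev (map flip L)" c''] by (simp add: line_rev)

section \<open>Robots moving along a line\<close>

text \<open>\<open>robot_moves G {}\<close> consists of the traversals alone. Tunnels are disjoint,
  so the location entered determines the exit.\<close>

lemma traverse_pass:
  assumes "((c, entry x), (c', p)) \<in> robot_moves G {}" "{fst (snd x), snd (snd x)} \<in> T"
  shows "(c, c') \<in> pass G x \<and> p = exit x"
proof -
  obtain i a b where x: "x = (i, a, b)"
    by (cases x)
  show ?thesis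
    using assms(1)
  proof cases
    case (traverse j a' b' s')
    then have "b' = b"
      using assms(2) tunnel_exit trans_tunnel by (auto simp: x)
    then show ?thesis
      using traverse by (auto simp: x)
  qed auto
qed

lemma robot_moves_cases:
  assumes "((c, p), (c', p')) \<in> robot_moves G E"
  obtains "(p, p') \<in> E" "c' = c" | "((c, p), (c', p')) \<in> robot_moves G {}"
  using assms by cases (use that in \<open>auto intro: robot_moves.traverse\<close>)

lemma robot_moves_pass: "(c, c') \<in> pass G x \<Longrightarrow> ((c, entry x), (c', exit x)) \<in> robot_moves G E"
  by (cases x) (auto intro: robot_moves.traverse)

text \<open>
  A robot that turns around can only undo its last passage, so it always stands where some prefix
  of the line has been traversed.
\<close>

lemma robot_on_line:
  assumes L: "laid_out E L" "\<forall>(i, a, b) \<in> set L. {a, b} \<in> T"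
    and "((c, entry (hd L)), (c', p)) \<in> (robot_moves G E)\<^sup>*"
  shows "\<exists>m\<le>length L. (c, c') \<in> line G (take m L) \<and>
    (m < length L \<and> p = entry (L ! m) \<or> 0 < m \<and> p = exit (L ! (m - 1)))"
  using assms(3)
proof (induction c' p rule: rtrancl_induct2)
  case refl
  then show ?case
    using L(1) by (intro exI[of _ 0]) (auto simp: laid_out_def hd_conv_nth)
next
  case (step c' p c'' p'')
  have tun: "{fst (snd (L ! j)), snd (snd (L ! j))} \<in> T" if "j < length L" for j
    using L(2) nth_mem[OF that] by (cases "L ! j") auto
  note edges = laid_outD(3,4)[OF L(1)]
  obtain m where m: "m \<le> length L" "(c, c') \<in> line G (take m L)"
    "m < length L \<and> p = entry (L ! m) \<or> 0 < m \<and> p = exit (L ! (m - 1))"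
    using step.IH by blast
  from step.hyps(2) show ?case
  proof (cases rule: robot_moves_cases)
    case 1
    \<comment> \<open>A walk joins the exit of passage \<open>m - 1\<close> and the entry of passage
      \<open>m\<close>, in either direction, so \<open>m\<close> stays the same.\<close>
    then have "m < length L \<and> p'' = entry (L ! m) \<or> 0 < m \<and> p'' = exit (L ! (m - 1))"
      using m(1,3) by (cases m) (auto simp: edges)
    then show ?thesis
      using m 1 by auto
  next
    case 2
    from m(3) show ?thesis
    proof (elim disjE conjE)
      assume "m < length L" "p = entry (L ! m)"
      then have "(c', c'') \<in> pass G (L ! m)" "p'' = exit (L ! m)"
        using traverse_pass[of c' "L ! m"] 2 tun by auto
      then show ?thesis
        using m \<open>m < length L\<close>
        by (intro exI[of _ "Suc m"]) (auto simp: take_Suc_conv_app_nth line_append)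
    next
      \<comment> \<open>The robot turns around after passage \<open>j\<close>. By determinism the
        flipped passage restores the configuration \<open>d\<close> from before, and the traversed
        prefix shrinks to length \<open>j\<close>.\<close>
      assume "0 < m" and p: "p = exit (L ! (m - 1))"
      then obtain j where j: "m = Suc j" "j < length L"
        using m(1) by (cases m) auto
      have "(c', c'') \<in> pass G (flip (L ! j)) \<and> p'' = exit (flip (L ! j))"
        by (rule traverse_pass) (use 2 tun[OF j(2)] j p in \<open>cases "L ! j"; auto simp: insert_commute\<close>)+
      moreover obtain d where d: "(c, d) \<in> line G (take j L)" "(d, c') \<in> pass G (L ! j)"
        using m(2) j by (auto simp: take_Suc_conv_app_nth line_append)
      moreover from this have "(c', d) \<in> pass G (flip (L ! j))"
        by (simp add: pass_flip)
      ultimately have "c'' = d" "p'' = entry (L ! j)"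
        using single_valued_pass[of "flip (L ! j)"] by (auto simp: single_valued_def)
      then show ?thesis
        using d j by (intro exI[of _ j]) auto
    qed
  qed
qed

lemma robot_through_line:
  assumes L: "laid_out E L" and "(c, c') \<in> line G L"
  shows "((c, entry (hd L)), (c', exit (last L))) \<in> (robot_moves G E)\<^sup>*"
proof -
  have "((c, entry (hd L)), (c', exit (L ! m))) \<in> (robot_moves G E)\<^sup>*"
    if "m < length L" "(c, c') \<in> line G (take (Suc m) L)" for m c'
    using that
  proof (induction m arbitrary: c')
    case 0
    then show ?case
      by (cases L) (auto intro: robot_moves_pass)
  next
    case (Suc m)
    then obtain d where d: "(c, d) \<in> line G (take (Suc m) L)" "(d, c') \<in> pass G (L ! Suc m)"
      by (auto simp: take_Suc_conv_app_nth[of "Suc m"] line_append)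
    have "((c, entry (hd L)), (d, exit (L ! m))) \<in> (robot_moves G E)\<^sup>*"
      using Suc d by simp
    also have "((d, exit (L ! m)), (d, entry (L ! Suc m))) \<in> robot_moves G E"
      using L Suc.prems(1) by (intro robot_moves.walk) (simp add: laid_outD)
    also have "((d, entry (L ! Suc m)), (c', exit (L ! Suc m))) \<in> robot_moves G E"
      using d by (intro robot_moves_pass)
    finally show ?case .
  qed
  from this[of "length L - 1"] show ?thesis
    using assms by (auto simp: laid_out_def last_conv_nth)
qed

text \<open>All ends of passages are distinct, so a robot at the last exit can only have the whole
  line as its traversed prefix.\<close>

lemma robot_reaches_exit:
  assumes L: "laid_out E L" "\<forall>(i, a, b) \<in> set L. {a, b} \<in> T"
  shows "((c, entry (hd L)), (c', exit (last L))) \<in> (robot_moves G E)\<^sup>* \<longleftrightarrow> (c, c') \<in> line G L"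
proof
  assume "((c, entry (hd L)), (c', exit (last L))) \<in> (robot_moves G E)\<^sup>*"
  from robot_on_line[OF L this] obtain m where m: "m \<le> length L" "(c, c') \<in> line G (take m L)"
    "m < length L \<and> exit (last L) = entry (L ! m) \<or> 0 < m \<and> exit (last L) = exit (L ! (m - 1))"
    by blast
  have dist: "distinct (map exit L)" "entry ` set L \<inter> exit ` set L = {}" and ne: "L \<noteq> []"
    using L(1) by (auto simp: laid_out_def)
  have "exit (last L) \<noteq> entry (L ! m)" if "m < length L"
    using dist(2) ne that by (metis disjoint_iff imageI last_in_set nth_mem)
  then have "0 < m" "map exit L ! (length L - 1) = map exit L ! (m - 1)"
    using m ne by (auto simp: last_conv_nth)
  then have "m = length L"
    using dist(1) m(1) ne by (subst (asm) nth_eq_iff_index_eq) auto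
  then show "(c, c') \<in> line G L"
    using m(2) by simp
qed (rule robot_through_line[OF L(1)])

text \<open>At the first entry the traversed prefix must be empty: coming back means having undone
  everything.\<close>

lemma robot_reaches_entry:
  assumes L: "laid_out E L" "\<forall>(i, a, b) \<in> set L. {a, b} \<in> T"
  shows "((c, entry (hd L)), (c', entry (hd L))) \<in> (robot_moves G E)\<^sup>* \<longleftrightarrow> c' = c"
proof
  assume "((c, entry (hd L)), (c', entry (hd L))) \<in> (robot_moves G E)\<^sup>*"
  from robot_on_line[OF L this] obtain m where m: "m \<le> length L" "(c, c') \<in> line G (take m L)"
    "m < length L \<and> entry (hd L) = entry (L ! m) \<or> 0 < m \<and> entry (hd L) = exit (L ! (m - 1))"
    by blast
  have dist: "distinct (map entry L)" "entry ` set L \<inter> exit ` set L = {}" and ne: "L \<noteq> []"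
    using L(1) by (auto simp: laid_out_def)
  have "entry (hd L) \<noteq> exit (L ! (m - 1))" if "0 < m"
    using dist(2) ne that m(1)
    by (metis One_nat_def Suc_pred disjoint_iff imageI hd_in_set nth_mem Suc_le_eq)
  then have "m < length L" "map entry L ! 0 = map entry L ! m"
    using m ne by (auto simp: hd_conv_nth)
  then have "m = 0"
    using dist(1) ne by (subst (asm) nth_eq_iff_index_eq) auto
  then show "c' = c"
    using m(2) by simp
qed auto

lemma robot_stays_on_line:
  assumes L: "laid_out E L" "\<forall>(i, a, b) \<in> set L. {a, b} \<in> T"
    and "p \<notin> entry ` set L \<union> exit ` set L"
  shows "((c, entry (hd L)), (c', p)) \<notin> (robot_moves G E)\<^sup>*"
proof
  assume "((c, entry (hd L)), (c', p)) \<in> (robot_moves G E)\<^sup>*"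
  from robot_on_line[OF L this] obtain m where "m \<le> length L"
    "m < length L \<and> p = entry (L ! m) \<or> 0 < m \<and> p = exit (L ! (m - 1))"
    by blast
  then have "p \<in> entry ` set L \<union> exit ` set L"
    by (cases m) auto
  with assms(3) show False ..
qed

section \<open>Two lines forming a locking 2-toggle\<close>

text \<open>\<open>X\<close> plays the tunnel from \<open>L2T_a1\<close> to \<open>L2T_b1\<close>,
  and \<open>Y\<close> the one from \<open>L2T_a2\<close> to \<open>L2T_b2\<close>. The exclusions
  leave only \<open>M\<close> to \<open>S1\<close> along \<open>X\<close>, \<open>M\<close> to
  \<open>S2\<close> along \<open>Y\<close>, and their reversals; since lines are partial injections,
  no fourth configuration arises.\<close>

lemma simulates_locking_2_toggle_by_lines:
  assumes ne: "X \<noteq> []" "Y \<noteq> []"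
    and dist: "distinct (map entry (X @ Y) @ map exit (X @ Y))"
    and tun: "\<forall>(i, a, b) \<in> set (X @ Y). i < n \<and> {a, b} \<in> T"
    and conf: "M \<in> configurations G n" "S1 \<in> configurations G n" "S2 \<in> configurations G n"
    and X: "(M, S1) \<in> line G X" "M \<notin> Range (line G X)" "S1 \<notin> Domain (line G X)"
      "S2 \<notin> Domain (line G X)" "S2 \<notin> Range (line G X)"
    and Y: "(M, S2) \<in> line G Y" "M \<notin> Range (line G Y)" "S2 \<notin> Domain (line G Y)"
      "S1 \<notin> Domain (line G Y)" "S1 \<notin> Range (line G Y)"
  shows "simulates G locking_2_toggle"
proof -
  define E where "E = series X \<union> (series X)\<inverse> \<union> series Y \<union> (series Y)\<inverse>"
  have laid: "laid_out E X" "laid_out E Y"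
  proof -
    show "laid_out E X"
      using ne(1) dist E_def by (rule laid_out_series)
    have "distinct (map entry (Y @ X) @ map exit (Y @ X))"
      using dist unfolding map_append distinct_append set_append by blast
    moreover have "E = series Y \<union> (series Y)\<inverse> \<union> series X \<union> (series X)\<inverse>"
      unfolding E_def by blast
    ultimately show "laid_out E Y"
      using ne(2) laid_out_series by blast
  qed
  have tunX: "\<forall>(i, a, b) \<in> set X. {a, b} \<in> T" and tunY: "\<forall>(i, a, b) \<in> set Y. {a, b} \<in> T"
    using tun by fastforce+
  have flip_tun: "\<forall>(i, a, b) \<in> set (rev (map flip L)). {a, b} \<in> T"
    if "\<forall>(i, a, b) \<in> set L. {a, b} \<in> T" for L
    using that by (fastforce simp: insert_commute)
  have ends: "entry (hd (rev (map flip L))) = exit (last L)"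
    "exit (last (rev (map flip L))) = entry (hd L)" if "L \<noteq> []" for L :: "(nat \<times> 'l \<times> 'l) list"
    using that by (simp_all add: hd_rev last_rev last_map hd_map)
  \<comment> \<open>The second and fourth equivalences are the first and third for the reversed
    line.\<close>
  have reach:
    "((c, entry (hd L)), (c', exit (last L))) \<in> (robot_moves G E)\<^sup>* \<longleftrightarrow> (c, c') \<in> line G L"
    "((c, exit (last L)), (c', entry (hd L))) \<in> (robot_moves G E)\<^sup>* \<longleftrightarrow> (c', c) \<in> line G L"
    "((c, entry (hd L)), (c', entry (hd L))) \<in> (robot_moves G E)\<^sup>* \<longleftrightarrow> c' = c"
    "((c, exit (last L)), (c', exit (last L))) \<in> (robot_moves G E)\<^sup>* \<longleftrightarrow> c' = c"
    if "laid_out E L" "\<forall>(i, a, b) \<in> set L. {a, b} \<in> T" "L \<noteq> []" for L c c'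
    using robot_reaches_exit[OF that(1,2)] robot_reaches_entry[OF that(1,2)]
      robot_reaches_exit[OF laid_out_rev[OF that(1)] flip_tun[OF that(2)]]
      robot_reaches_entry[OF laid_out_rev[OF that(1)] flip_tun[OF that(2)]]
    by (simp_all only: ends[OF that(3)] line_rev converse_iff)
  have apart:
    "((c, entry (hd L)), (c', p)) \<notin> (robot_moves G E)\<^sup>*"
    "((c, exit (last L)), (c', p)) \<notin> (robot_moves G E)\<^sup>*"
    if "laid_out E L" "\<forall>(i, a, b) \<in> set L. {a, b} \<in> T" "L \<noteq> []"
      "p \<notin> entry ` set L \<union> exit ` set L" for L c c' p
  proof -
    show "((c, entry (hd L)), (c', p)) \<notin> (robot_moves G E)\<^sup>*"
      using robot_stays_on_line that(1,2,4) .
    have "entry ` set (rev (map flip L)) \<union> exit ` set (rev (map flip L)) =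
        entry ` set L \<union> exit ` set L"
      by (auto simp: image_image)
    then show "((c, exit (last L)), (c', p)) \<notin> (robot_moves G E)\<^sup>*"
      using robot_stays_on_line[OF laid_out_rev[OF that(1)] flip_tun[OF that(2)]] that(4)
      by (simp only: ends[OF that(3)] simp_thms)
  qed
  have mem: "hd X \<in> set X" "last X \<in> set X" "hd Y \<in> set Y" "last Y \<in> set Y"
    using ne by auto
  have ends_disjoint: "(entry ` set X \<union> entry ` set Y) \<inter> (exit ` set X \<union> exit ` set Y) = {}"
    "entry ` set X \<inter> entry ` set Y = {}" "exit ` set X \<inter> exit ` set Y = {}"
    using dist by (simp_all only: distinct_append map_append set_map set_append)
  have off: "entry (hd X) \<notin> entry ` set Y \<union> exit ` set Y" "exit (last X) \<notin> entry ` set Y \<union> exit ` set Y"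
    "entry (hd Y) \<notin> entry ` set X \<union> exit ` set X" "exit (last Y) \<notin> entry ` set X \<union> exit ` set X"
    and exits: "entry (hd X) \<noteq> exit (last X)" "entry (hd Y) \<noteq> exit (last Y)"
    using ends_disjoint imageI[OF mem(1), of entry] imageI[OF mem(2), of exit]
      imageI[OF mem(3), of entry] imageI[OF mem(4), of exit]
    by (metis Un_iff disjoint_iff)+
  then have ports: "entry (hd X) \<noteq> entry (hd Y)" "entry (hd X) \<noteq> exit (last Y)"
    "exit (last X) \<noteq> entry (hd Y)" "exit (last X) \<noteq> exit (last Y)"
    using mem by auto
  define port where "port a = (case a of L2T_a1 \<Rightarrow> entry (hd X) | L2T_b1 \<Rightarrow> exit (last X)
      | L2T_a2 \<Rightarrow> entry (hd Y) | L2T_b2 \<Rightarrow> exit (last Y))" for a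
  define cfg where "cfg q = (case q of L2T_M \<Rightarrow> M | L2T_S1 \<Rightarrow> S1 | L2T_S2 \<Rightarrow> S2)" for q
  have locs: "entry x \<in> system_locs G n" "exit x \<in> system_locs G n" if "x \<in> set (X @ Y)" for x
    using bspec[OF tun that] by (cases x; auto simp: system_locs_def dest: tunnel_locs)+
  have "series L \<subseteq> system_locs G n \<times> system_locs G n" if "set L \<subseteq> set (X @ Y)" for L
    unfolding series_def using locs subsetD[OF that nth_mem] by (blast dest: Suc_lessD)
  from this[of X] this[of Y] have 1: "connection_graph G n E"
    unfolding connection_graph_def E_def by (auto intro!: symI)
  have 2: "inj_on port (locs locking_2_toggle)"
    using ports exits by (auto simp: inj_on_def port_def locking_2_toggle_def)
  have 3: "port ` locs locking_2_toggle \<subseteq> system_locs G n"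
    using locs mem by (auto simp: port_def locking_2_toggle_def)
  have 4: "cfg ` states locking_2_toggle \<subseteq> configurations G n"
    using conf by (auto simp: cfg_def locking_2_toggle_def)
  note reachs = reach[OF laid(1) tunX ne(1)] reach[OF laid(2) tunY ne(2)]
    apart[OF laid(1) tunX ne(1) off(3)] apart[OF laid(1) tunX ne(1) off(4)]
    apart[OF laid(2) tunY ne(2) off(1)] apart[OF laid(2) tunY ne(2) off(2)]
  have neq: "M \<noteq> S1" "M \<noteq> S2" "S1 \<noteq> S2"
    using X(1,2) Y(1,2,5) by auto
  have linX: "(c, M) \<notin> line G X" "(S1, c) \<notin> line G X" "(S2, c) \<notin> line G X" "(c, S2) \<notin> line G X"
    "(M, c) \<in> line G X \<longleftrightarrow> c = S1" "(c, S1) \<in> line G X \<longleftrightarrow> c = M" for c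
    using X line_unique[OF X(1)] line_unique_rev[OF X(1)] by auto
  have linY: "(c, M) \<notin> line G Y" "(S2, c) \<notin> line G Y" "(S1, c) \<notin> line G Y" "(c, S1) \<notin> line G Y"
    "(M, c) \<in> line G Y \<longleftrightarrow> c = S2" "(c, S2) \<in> line G Y \<longleftrightarrow> c = M" for c
    using Y line_unique[OF Y(1)] line_unique_rev[OF Y(1)] by auto
  \<comment> \<open>As \<open>c\<close> is arbitrary, this yields both clauses of
    \<open>simulates\<close>: the correct transitions, and that the robot leaves only configurations
    of toggle states behind.\<close>
  have "((cfg q, port a), (c, port b)) \<in> (robot_moves G E)\<^sup>* \<longleftrightarrow>
      (\<exists>q'. c = cfg q' \<and> ((q, a), (q', b)) \<in> (transition_graph locking_2_toggle)\<^sup>*)" for q a c b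
    unfolding locking_2_toggle_rtrancl
    by (cases q; cases a; cases b)
      (auto simp: cfg_def port_def locking_2_toggle_def reachs linX linY)
  moreover have "cfg q = cfg q' \<longleftrightarrow> q = q'" for q q'
    using neq by (cases q; cases q') (auto simp: cfg_def)
  moreover have "q \<in> states locking_2_toggle" for q
    by (cases q) (auto simp: locking_2_toggle_def)
  ultimately show ?thesis
    unfolding simulates_def using 1 2 3 4
    by (intro exI[of _ n] exI[of _ E] exI[of _ port] exI[of _ cfg]) auto
qed

section \<open>Choice of the tunnels and of a one-way word\<close>

text \<open>A transition that changes the directions of another tunnel closes or opens some passage
  \<open>(c, d)\<close>. If it opens it, the reversed transition closes it.\<close>

lemma interacting_obtains:
  assumes "interacting_tunnels T G"
  obtains s a b s' c d s2 where "(s, a, b, s') \<in> trans G" "(s, c, d, s2) \<in> trans G"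
    "\<nexists>s''. (s', c, d, s'') \<in> trans G" "{a, b} \<noteq> {c, d}"
proof -
  obtain z where "z \<in> trans G"
    "case z of (s, a, b, s') \<Rightarrow> \<exists>t\<in>T. t \<noteq> {a, b} \<and> directions G t s \<noteq> directions G t s'"
    using assms unfolding interacting_tunnels_def by (rule bexE)
  then obtain s a b s' t where tr: "(s, a, b, s') \<in> trans G" and t: "t \<noteq> {a, b}"
    and "directions G t s \<noteq> directions G t s'"
    by (cases z) (simp, metis)
  then obtain c d where "(c, d) \<in> directions G t s \<longleftrightarrow> (c, d) \<notin> directions G t s'"
    by (metis set_eqI surj_pair)
  then consider s2 where "t = {c, d}" "(s, c, d, s2) \<in> trans G" "\<nexists>s''. (s', c, d, s'') \<in> trans G"
    | s2 where "t = {c, d}" "(s', c, d, s2) \<in> trans G" "\<nexists>s''. (s, c, d, s'') \<in> trans G"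
    unfolding directions_def by blast
  then show thesis
  proof cases
    case 1
    then show ?thesis
      using that tr t by blast
  next
    case 2
    then show ?thesis
      using that[OF trans_rev[OF tr]] t by (simp add: insert_commute)
  qed
qed

lemma path_injective:
  shows "single_valued (path G w)" "single_valued ((path G w)\<inverse>)"
proof -
  have "single_valued {(s, s'). (s, a, b, s') \<in> trans G}" for a b
    by (auto simp: single_valued_def dest: trans_unique)
  then show "single_valued (path G w)"
    by (induction w) (auto intro: single_valued_relcomp)
  have "single_valued ({(s, s'). (s, a, b, s') \<in> trans G}\<inverse>)" for a b
    by (auto simp: single_valued_def dest: trans_unique[OF trans_rev trans_rev])
  then show "single_valued ((path G w)\<inverse>)"
    by (induction w) (auto simp: converse_relcomp intro: single_valued_relcomp)
qed

text \<open>The empty word is excluded because its path is \<open>Id\<close> on the whole type of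
  states.\<close>

lemma path_states: "(s, s') \<in> path G w \<Longrightarrow> w \<noteq> [] \<Longrightarrow> s \<in> states G \<and> s' \<in> states G"
  by (induction w arbitrary: s) (force dest: trans_states)+

lemma finite_path: "w \<noteq> [] \<Longrightarrow> finite (path G w)"
  by (rule finite_subset[of _ "states G \<times> states G"])
    (use tunnel_gadget in \<open>auto simp: tunnel_gadget_def is_gadget_def dest: path_states\<close>)

text \<open>If neither single passage has a domain different from its range,
  \<open>Domain_neq_Range_relcomp\<close> applies to their composition, with \<open>s'\<close> as
  the state where the second passage is blocked.\<close>

lemma one_way_path_obtains:
  assumes "(s, a, b, s') \<in> trans G" "(s, c, d, s2) \<in> trans G" "\<nexists>s''. (s', c, d, s'') \<in> trans G"
  obtains w where "w \<in> {[(a, b)], [(c, d)], [(a, b), (c, d)]}" "Domain (path G w) \<noteq> Range (path G w)"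
proof (cases "Domain (path G [(a, b)]) = Range (path G [(a, b)]) \<and>
    Domain (path G [(c, d)]) = Range (path G [(c, d)])")
  case True
  have "Domain (path G [(a, b)] O path G [(c, d)]) \<noteq> Range (path G [(a, b)] O path G [(c, d)])"
    by (rule Domain_neq_Range_relcomp[where s = s and s' = s'])
      (use True path_injective[of "[(a, b)]"] finite_path[of "[(a, b)]"] assms in auto)
  then show thesis
    using that[of "[(a, b), (c, d)]"] by simp
qed (use that in blast)

end

section \<open>The system of six copies\<close>

theorem theorem2p3:
  fixes G :: "('q, 'l) gadget" and k :: nat and T :: "'l set set"
  assumes "tunnel_gadget k T G"
    and "reversible G"
    and "deterministic G"
    and "interacting_tunnels T G"
  shows "simulates G locking_2_toggle"
proof -
  interpret reversible_tunnels G T k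
    using assms by unfold_locales
  obtain s a b s' c d s2 where tr: "(s, a, b, s') \<in> trans G" "(s, c, d, s2) \<in> trans G"
    and blocked: "\<nexists>s''. (s', c, d, s'') \<in> trans G" and neq: "{a, b} \<noteq> {c, d}"
    using interacting_obtains[OF assms(4)] by metis
  obtain w where w: "w \<in> {[(a, b)], [(c, d)], [(a, b), (c, d)]}"
    and "Domain (path G w) \<noteq> Range (path G w)"
    using one_way_path_obtains[OF tr blocked] by metis
  moreover have "w \<noteq> []"
    using w by auto
  ultimately obtain x x' y y' where x: "(x, x') \<in> path G w" "x \<notin> Range (path G w)"
    and y: "(y, y') \<in> path G w" "y' \<notin> Domain (path G w)"
    using Domain_neq_Range_obtains[OF finite_path path_injective] by metis
  have T: "{a, b} \<in> T" "{c, d} \<in> T"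
    using tr by (blast intro: trans_tunnel)+
  then have locs: "a \<noteq> b" "c \<noteq> d" "a \<noteq> c" "a \<noteq> d" "b \<noteq> c" "b \<noteq> d"
    using tunnel_neq tunnels_disjoint[OF T neq] by auto
  define line2 where "line2 i j = map (Pair i) w @ map (Pair j) w" for i j :: nat
  \<comment> \<open>Copies 0 and 1 are shared by the two lines with exchanged roles; copies 2 and 3
    belong to \<open>X\<close> alone, copies 4 and 5 to \<open>Y\<close> alone.\<close>
  define X where "X = [(0, a, b), (1, c, d)] @ line2 2 3"
  define Y where "Y = [(1, a, b), (0, c, d)] @ line2 4 5"
  let ?M = "[s, s, x, y, x, y]" and ?S1 = "[s', s2, x', y', x, y]" and ?S2 = "[s2, s', x, y, x', y']"
  have toggle: "(m, m[i := x', j := y']) \<in> line G (line2 i j)"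
    if "m ! i = x" "m ! j = y" "i < length m" "j < length m" "i \<noteq> j" for m i j
    using line_map_Pair[of m i x' G w] line_map_Pair[of "m[i := x']" j y' G w] x(1) y(1) that
    by (auto simp: line2_def line_append)
  have path_X: "(m ! 1, m' ! 1) \<in> path G [(c, d)]" "(m ! 2, m' ! 2) \<in> path G w"
    "(m ! 3, m' ! 3) \<in> path G w" if "(m, m') \<in> line G X" "length m' = 6" for m m'
    using line_nth[OF that(1), of 1] line_nth[OF that(1), of 2] line_nth[OF that(1), of 3]
      line_length[OF that(1)] that(2)
    by (simp_all add: X_def line2_def filter_map comp_def)
  have path_Y: "(m ! 0, m' ! 0) \<in> path G [(c, d)]" "(m ! 4, m' ! 4) \<in> path G w"
    "(m ! 5, m' ! 5) \<in> path G w" if "(m, m') \<in> line G Y" "length m' = 6" for m m'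
    using line_nth[OF that(1), of 0] line_nth[OF that(1), of 4] line_nth[OF that(1), of 5]
      line_length[OF that(1)] that(2)
    by (simp_all add: Y_def line2_def filter_map comp_def del: length_greater_0_conv)
  show ?thesis
  proof (rule simulates_locking_2_toggle_by_lines[of X Y 6 ?M ?S1 ?S2])
    show "distinct (map entry (X @ Y) @ map exit (X @ Y))"
      using w locs by (auto simp: X_def Y_def line2_def)
    show "\<forall>(i, a, b) \<in> set (X @ Y). i < 6 \<and> {a, b} \<in> T"
      using w T by (auto simp: X_def Y_def line2_def)
    have "{s, s', s2, x, x', y, y'} \<subseteq> states G"
      using tr x(1) y(1) \<open>w \<noteq> []\<close> trans_states path_states by blast
    then show "?M \<in> configurations G 6" "?S1 \<in> configurations G 6" "?S2 \<in> configurations G 6"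
      by (auto simp: configurations_def)
    show "(?M, ?S1) \<in> line G X" "(?M, ?S2) \<in> line G Y"
      \<comment> \<open>The lists are the configurations after the two shared copies have been
        passed, before the one-way part.\<close>
      using tr toggle[of "[s', s2, x, y, x, y]" 2 3] toggle[of "[s2, s', x, y, x, y]" 4 5]
      by (auto simp: X_def Y_def intro!: relcompI)
    \<comment> \<open>In both configurations copy 2 is in state \<open>x\<close>, in which no
      traversal of \<open>w\<close> ends.\<close>
    show "?M \<notin> Range (line G X)" "?S2 \<notin> Range (line G X)"
      using x(2) path_X(2)[of _ ?M] path_X(2)[of _ ?S2] by auto
    show "?M \<notin> Range (line G Y)" "?S1 \<notin> Range (line G Y)"
      using x(2) path_Y(2)[of _ ?M] path_Y(2)[of _ ?S1] by auto
    \<comment> \<open>The second one-way copy of the line is in state \<open>y'\<close>, from which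
      \<open>w\<close> cannot be traversed.\<close>
    show "?S1 \<notin> Domain (line G X)" "?S2 \<notin> Domain (line G Y)"
      using y(2) path_X(3)[of ?S1] path_Y(3)[of ?S2] line_length[of ?S1 _ G X] line_length[of ?S2 _ G Y]
      by auto
    \<comment> \<open>Here the interaction enters: the other line has left the shared copy that must
      be passed from \<open>c\<close> to \<open>d\<close> in state \<open>s'\<close>.\<close>
    show "?S2 \<notin> Domain (line G X)" "?S1 \<notin> Domain (line G Y)"
      using blocked path_X(1)[of ?S2] path_Y(1)[of ?S1] line_length[of ?S2 _ G X] line_length[of ?S1 _ G Y]
      by auto
  qed (auto simp: X_def Y_def)
qed

end
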